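(* Let $(A,L,[\cdot,\cdot],(\cdot)^{[2]},\rho)$ be a restricted Lie-Rinehart algebra over a field $\mathbb F$ of characteristic $2$, with associated restricted multiderivation $(m,\omega)=([\cdot,\cdot],(\cdot)^{[2]})$. The second restricted cohomology space $H^2_{*_2}(L,L)$ classifies, up to equivalence, the infinitesimal restricted deformations of $(m,\omega)$.
   Context: All algebras are finite-dimensional. **Restricted Lie algebra in characteristic 2.** A Lie algebra $L$ with a map $(\cdot)^{[2]}:L\to L$ such that $(\lambda x)^{[2]}=\lambda^2x^{[2]}$, $[x,y^{[2]}]=[[x,y],y]$, $(x+y)^{[2]}=x^{[2]}+y^{[2]}+[x,y]$. **Restricted Lie-Rinehart algebra in characteristic 2.** $A$ is a commutative associative $\mathbb F$-algebra, $L$ is a restricted Lie algebra and an $A$-module, and $\rho:L\to\mathrm{Der}(A)$ (the anchor) is a morphism of Lie algebras and of $A$-modules with $[x,ay]=\rho(x)(a)y+a[x,y]$, $\rho(x^{[2]})=\rho(x)^2$ and $(ax)^{[2]}=a^2x^{[2]}+\rho(ax)(a)x$. **Restricted multiderivation (of order 1).** A pair $(m,\omega)$ with $m:L\times L\to L$ skew-symmetric bilinear and $\omega:L\to L$ with $\omega(\lambda x)=\lambda^2\omega(x)$ and $\omega(x+y)=\omega(x)+\omega(y)+m(x,y)$, such that there is a map $\sigma:L\to\mathrm{Der}(A)$ (restricted symbol map) with $\sigma(ax)=a\sigma(x)$, $m(x,ay)=am(x,y)+\sigma(x)(a)y$, $\sigma(\omega(x))=\sigma(x)^2$, $\omega(ax)=a^2\omega(x)+\sigma(ax)(a)x$.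 The multiderivation associated to a restricted Lie-Rinehart algebra has symbol map $\rho$. **Restricted formal deformation of $(m,\omega)$.** Maps $m_t=\sum_{i\ge0}t^im_i:L\times L\to L[[t]]$ and $\omega_t=\sum_{j\ge0}t^j\omega_j:L\to L[[t]]$ with $m_0=m$, $\omega_0=\omega$, each $(m_i,\omega_i)$ a restricted multiderivation with symbol map $\sigma_i$, such that for all $x,y,z\in L$: (1) $m_t(x,m_t(y,z))+m_t(y,m_t(z,x))+m_t(z,m_t(x,y))=0$; (2) $m_t(x,\omega_t(y))=m_t(m_t(x,y),y)$; (3) $\omega_t(x+y)=\omega_t(x)+\omega_t(y)+m_t(x,y)$; (4) $\sum_{i=0}^k\sigma_i(\omega_{k-i}(x))=\sum_{i=0}^k\sigma_i(x)\circ\sigma_{k-i}(x)$ for all $k\ge0$. Here $m_t$ is extended to $L[[t]]$ by $\mathbb F[[t]]$-linearity and $\omega_t$ by $\omega_t(\sum_it^ix_i)=\sum_it^{2i}\omega_t(x_i)+\sum_{i<j}t^{i+j}m_t(x_i,x_j)$. An infinitesimal restricted deformation is one given by $m_t=m+tm_1$, $\omega_t=\omega+t\omega_1$. **Equivalence.** $(m_t,\omega_t)$ and $(m_t',\omega_t')$ are equivalent if there is a formal automorphism $\phi_t=\sum_{i\ge0}t^i\phi_i$ of $L[[t]]$ ($\phi_i:L\to L$ linear, $\phi_0=\mathrm{id}$, extended by $\mathbb F[[t]]$-linearity) with $m_t(\phi_t(x),\phi_t(y))=\phi_t(m_t'(x,y))$ and $\phi_t(\omega_t(x))=\omega_t'(\phi_t(x))$.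 **Cohomology (adjoint coefficients).** $C^2_{*_2}(L,L)$ is the set of pairs $(\varphi,w)$ with $\varphi:L\times L\to L$ alternating bilinear and $w:L\to L$ with $w(\lambda x)=\lambda^2w(x)$, $w(x+y)=w(x)+w(y)+\varphi(x,y)$. $Z^2_{*_2}(L,L)$ consists of those with $\varphi([x,y],z)+\varphi([x,z],y)+\varphi([y,z],x)+[x,\varphi(y,z)]+[y,\varphi(x,z)]+[z,\varphi(x,y)]=0$ and $[x,\varphi(x,z)]+[z,w(x)]+\varphi(x^{[2]},z)+\varphi([x,z],x)=0$ for all $x,y,z\in L$. $B^2_{*_2}(L,L)$ consists of the pairs $(d^1_{CE}\psi,w)$, $\psi:L\to L$ linear, with $d^1_{CE}\psi(x,y)=\psi([x,y])+[x,\psi(y)]+[y,\psi(x)]$ and $w(x)=\psi(x^{[2]})+[x,\psi(x)]$. $H^2_{*_2}(L,L)=Z^2_{*_2}(L,L)/B^2_{*_2}(L,L)$.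
   Formalization: Deformation conditions and equivalences are taken modulo t^2, and equivalence classes are shown to biject with the classes in H^2 containing a cocycle that is a restricted multiderivation with compatible symbol map, not with all of H^2; the literal claims are false. *)

theory Defs
  imports "HOL-Computational_Algebra.Computational_Algebra" "HOL-Library.Extended_Nat"
begin

definition bilinear_map ::
    "('f::field \<Rightarrow> 'l::ab_group_add \<Rightarrow> 'l) \<Rightarrow> ('l \<Rightarrow> 'l \<Rightarrow> 'l) \<Rightarrow> bool" where
  "bilinear_map scL m \<longleftrightarrow>
     (\<forall>x. Vector_Spaces.linear scL scL (m x)) \<and> (\<forall>y. Vector_Spaces.linear scL scL (\<lambda>x. m x y))"

definition derivations ::
    "('f::field \<Rightarrow> 'a::comm_ring \<Rightarrow> 'a) \<Rightarrow> ('a \<Rightarrow> 'a) set" where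
  "derivations scA =
     {D. Vector_Spaces.linear scA scA D \<and> (\<forall>a b. D (a * b) = D a * b + a * D b)}"

locale restricted_lie_algebra = vector_space scL
  for scL :: "'f::field \<Rightarrow> 'l::ab_group_add \<Rightarrow> 'l" +
  fixes br :: "'l \<Rightarrow> 'l \<Rightarrow> 'l"
    and sq :: "'l \<Rightarrow> 'l"
  assumes char_2: "CHAR('f) = 2"
    and finite_dim: "\<exists>B. finite B \<and> span B = UNIV"
    and br_bilinear: "bilinear_map scL br"
    and br_self: "br x x = 0"
    and jacobi: "br x (br y z) + br y (br z x) + br z (br x y) = 0"
    and sq_scale: "sq (scL c x) = scL (c ^ 2) (sq x)"
    and br_sq: "br x (sq y) = br (br x y) y"
    and sq_add: "sq (x + y) = sq x + sq y + br x y"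

text \<open>
  The algebra \<open>A\<close> is a type of class \<^class>\<open>comm_ring\<close>: it need not have a unit. A unital
  \<open>A\<close> acting unitally on \<open>L\<close> is a special case. The action of \<open>A\<close> on \<open>L\<close> is \<open>act\<close>, and
  \<open>rho x a\<close> is the anchor \<open>\<rho>(x)(a)\<close>.
\<close>

locale restricted_lie_rinehart =
  restricted_lie_algebra scL br sq + A: vector_space scA
  for scA :: "'f::field \<Rightarrow> 'a::comm_ring \<Rightarrow> 'a"
    and scL :: "'f \<Rightarrow> 'l::ab_group_add \<Rightarrow> 'l"
    and act :: "'a \<Rightarrow> 'l \<Rightarrow> 'l"
    and br :: "'l \<Rightarrow> 'l \<Rightarrow> 'l"
    and sq :: "'l \<Rightarrow> 'l"
    and rho :: "'l \<Rightarrow> 'a \<Rightarrow> 'a" +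
  assumes A_finite_dim: "\<exists>B. finite B \<and> A.span B = UNIV"
    and A_scale_mult: "scA c (a * b) = scA c a * b"
    and act_add_left: "act (a + b) x = act a x + act b x"
    and act_add_right: "act a (x + y) = act a x + act a y"
    and act_mult: "act (a * b) x = act a (act b x)"
    and act_scale_left: "act (scA c a) x = scL c (act a x)"
    and act_scale_right: "act a (scL c x) = scL c (act a x)"
    and rho_derivation: "rho x \<in> derivations scA"
    and rho_add: "rho (x + y) a = rho x a + rho y a"
    and rho_scale: "rho (scL c x) a = scA c (rho x a)"
    and rho_act: "rho (act b x) a = b * rho x a"
    and rho_br: "rho (br x y) a = rho x (rho y a) - rho y (rho x a)"
    and br_act: "br x (act a y) = act (rho x a) y + act a (br x y)"
    and rho_sq: "rho (sq x) a = rho x (rho x a)"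
    and sq_act: "sq (act a x) = act (a * a) (sq x) + act (rho (act a x) a) x"

section \<open>Restricted multiderivations\<close>

definition is_quadratic_over ::
    "('f::field \<Rightarrow> 'l::ab_group_add \<Rightarrow> 'l) \<Rightarrow> ('l \<Rightarrow> 'l \<Rightarrow> 'l) \<Rightarrow> ('l \<Rightarrow> 'l) \<Rightarrow> bool" where
  "is_quadratic_over scL m w \<longleftrightarrow>
     (\<forall>c x. w (scL c x) = scL (c ^ 2) (w x)) \<and> (\<forall>x y. w (x + y) = w x + w y + m x y)"

text \<open>
  \<open>s\<close> is a restricted symbol map of \<open>(m, w)\<close>. As the symbol map need not be unique (the
  \<open>A\<close>-module \<open>L\<close> need not be faithful), it is an explicit argument. No linearity over \<open>'f\<close>
  is imposed on it.
\<close>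

definition multiderivation_with_symbol ::
    "('f::field \<Rightarrow> 'a::comm_ring \<Rightarrow> 'a) \<Rightarrow> ('f \<Rightarrow> 'l::ab_group_add \<Rightarrow> 'l) \<Rightarrow> ('a \<Rightarrow> 'l \<Rightarrow> 'l) \<Rightarrow>
     ('l \<Rightarrow> 'l \<Rightarrow> 'l) \<Rightarrow> ('l \<Rightarrow> 'l) \<Rightarrow> ('l \<Rightarrow> 'a \<Rightarrow> 'a) \<Rightarrow> bool" where
  "multiderivation_with_symbol scA scL act m w s \<longleftrightarrow>
     bilinear_map scL m \<and> (\<forall>x y. m x y = - m y x) \<and> is_quadratic_over scL m w \<and>
     (\<forall>x. s x \<in> derivations scA) \<and>
     (\<forall>a x b. s (act a x) b = a * s x b) \<and>
     (\<forall>x a y. m x (act a y) = act a (m x y) + act (s x a) y) \<and>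
     (\<forall>x a. s (w x) a = s x (s x a)) \<and>
     (\<forall>a x. w (act a x) = act (a * a) (w x) + act (s (act a x) a) x)"

section \<open>Formal deformations\<close>

text \<open>
  \<open>L[[t]]\<close> is the type of power series \<open>'l fps\<close>. A pair \<open>(m\<^sub>t, \<omega>\<^sub>t)\<close> is a pair of maps into
  \<open>'l fps\<close>, with coefficients \<open>m\<^sub>i x y = mt x y $ i\<close> and \<open>\<omega>\<^sub>i x = wt x $ i\<close>. The next three
  definitions are the extensions of \<open>m\<^sub>t\<close>, \<open>\<omega>\<^sub>t\<close> and \<open>\<phi>\<^sub>t\<close> to \<open>L[[t]]\<close>, written coefficientwise.
\<close>

definition ext_m :: "('l::ab_group_add \<Rightarrow> 'l \<Rightarrow> 'l fps) \<Rightarrow> 'l fps \<Rightarrow> 'l fps \<Rightarrow> 'l fps" where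
  "ext_m mt X Y = Abs_fps (\<lambda>n. \<Sum>i\<le>n. \<Sum>j\<le>n - i. mt (X $ i) (Y $ j) $ (n - i - j))"

definition ext_w ::
    "('l::ab_group_add \<Rightarrow> 'l \<Rightarrow> 'l fps) \<Rightarrow> ('l \<Rightarrow> 'l fps) \<Rightarrow> 'l fps \<Rightarrow> 'l fps" where
  "ext_w mt wt X = Abs_fps (\<lambda>n.
     (\<Sum>i\<in>{i. 2 * i \<le> n}. wt (X $ i) $ (n - 2 * i)) +
     (\<Sum>(i, j)\<in>{(i, j). i < j \<and> i + j \<le> n}. mt (X $ i) (X $ j) $ (n - i - j)))"

definition ext_lin :: "('l::ab_group_add \<Rightarrow> 'l fps) \<Rightarrow> 'l fps \<Rightarrow> 'l fps" where
  "ext_lin \<phi>t X = Abs_fps (\<lambda>n. \<Sum>i\<le>n. \<phi>t (X $ i) $ (n - i))"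

text \<open>Equality modulo \<open>t\<^sup>N\<^sup>+\<^sup>1\<close>; for \<open>N = \<infinity>\<close> it is equality.\<close>

definition eq_upto :: "enat \<Rightarrow> 'l::zero fps \<Rightarrow> 'l fps \<Rightarrow> bool" where
  "eq_upto N X Y \<longleftrightarrow> (\<forall>n. enat n \<le> N \<longrightarrow> X $ n = Y $ n)"

text \<open>
  Deformations of order \<open>N\<close>, that is over \<open>\<bbbF>[t]/(t\<^sup>N\<^sup>+\<^sup>1)\<close>, represented by their polynomial
  representatives of degree at most \<open>N\<close>. For \<open>N = \<infinity>\<close> these are the restricted formal
  deformations, and for \<open>N = 1\<close> the infinitesimal ones. Infinitesimal deformations and their
  equivalences are taken modulo \<open>t\<^sup>2\<close>: over \<open>\<bbbF>[[t]]\<close>, two deformations \<open>m + t m\<^sub>1\<close>,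
  \<open>m + t m\<^sub>1'\<close> with cohomologous \<open>m\<^sub>1\<close>, \<open>m\<^sub>1'\<close> need not be equivalent, even if \<open>A = \<bbbF>\<close>.
\<close>

definition restricted_deformations ::
    "enat \<Rightarrow> ('f::field \<Rightarrow> 'a::comm_ring \<Rightarrow> 'a) \<Rightarrow> ('f \<Rightarrow> 'l::ab_group_add \<Rightarrow> 'l) \<Rightarrow> ('a \<Rightarrow> 'l \<Rightarrow> 'l) \<Rightarrow>
     ('l \<Rightarrow> 'l \<Rightarrow> 'l) \<Rightarrow> ('l \<Rightarrow> 'l) \<Rightarrow> ('l \<Rightarrow> 'a \<Rightarrow> 'a) \<Rightarrow>
     (('l \<Rightarrow> 'l \<Rightarrow> 'l fps) \<times> ('l \<Rightarrow> 'l fps)) set" where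
  "restricted_deformations N scA scL act m w rho = {(mt, wt).
     (\<forall>x y. mt x y $ 0 = m x y) \<and> (\<forall>x. wt x $ 0 = w x) \<and>
     (\<forall>i. N < enat i \<longrightarrow> (\<forall>x y. mt x y $ i = 0) \<and> (\<forall>x. wt x $ i = 0)) \<and>
     (\<forall>x y z. eq_upto N
        (ext_m mt (fps_const x) (mt y z) + ext_m mt (fps_const y) (mt z x)
          + ext_m mt (fps_const z) (mt x y)) 0) \<and>
     (\<forall>x y. eq_upto N (ext_m mt (fps_const x) (wt y)) (ext_m mt (mt x y) (fps_const y))) \<and>
     (\<forall>x y. eq_upto N (wt (x + y)) (wt x + wt y + mt x y)) \<and>
     (\<exists>\<sigma> :: nat \<Rightarrow> 'l \<Rightarrow> 'a \<Rightarrow> 'a.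
        \<sigma> 0 = rho \<and>
        (\<forall>i. enat i \<le> N \<longrightarrow>
           multiderivation_with_symbol scA scL act (\<lambda>x y. mt x y $ i) (\<lambda>x. wt x $ i) (\<sigma> i)) \<and>
        (\<forall>k. enat k \<le> N \<longrightarrow>
           (\<forall>x a. (\<Sum>i\<le>k. \<sigma> i (wt x $ (k - i)) a) = (\<Sum>i\<le>k. \<sigma> i x (\<sigma> (k - i) x a)))))}"

text \<open>
  Since \<open>\<phi>\<^sub>0\<close> is the identity, the extension of \<open>\<phi>\<^sub>t\<close> to \<open>L[[t]]\<close> is automatically bijective.
\<close>

definition deformation_equiv ::
    "enat \<Rightarrow> ('f::field \<Rightarrow> 'l::ab_group_add \<Rightarrow> 'l) \<Rightarrow>
     ('l \<Rightarrow> 'l \<Rightarrow> 'l fps) \<times> ('l \<Rightarrow> 'l fps) \<Rightarrow> ('l \<Rightarrow> 'l \<Rightarrow> 'l fps) \<times> ('l \<Rightarrow> 'l fps) \<Rightarrow> bool" where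
  "deformation_equiv N scL d d' \<longleftrightarrow> (case (d, d') of ((mt, wt), (mt', wt')) \<Rightarrow>
     (\<exists>\<phi>t :: 'l \<Rightarrow> 'l fps.
        (\<forall>i. Vector_Spaces.linear scL scL (\<lambda>x. \<phi>t x $ i)) \<and> (\<forall>x. \<phi>t x $ 0 = x) \<and>
        (\<forall>x y. eq_upto N (ext_m mt (\<phi>t x) (\<phi>t y)) (ext_lin \<phi>t (mt' x y))) \<and>
        (\<forall>x. eq_upto N (ext_lin \<phi>t (wt x)) (ext_w mt' wt' (\<phi>t x)))))"

definition infinitesimal_deformations ::
    "('f::field \<Rightarrow> 'a::comm_ring \<Rightarrow> 'a) \<Rightarrow> ('f \<Rightarrow> 'l::ab_group_add \<Rightarrow> 'l) \<Rightarrow> ('a \<Rightarrow> 'l \<Rightarrow> 'l) \<Rightarrow>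
     ('l \<Rightarrow> 'l \<Rightarrow> 'l) \<Rightarrow> ('l \<Rightarrow> 'l) \<Rightarrow> ('l \<Rightarrow> 'a \<Rightarrow> 'a) \<Rightarrow>
     (('l \<Rightarrow> 'l \<Rightarrow> 'l fps) \<times> ('l \<Rightarrow> 'l fps)) set" where
  "infinitesimal_deformations = restricted_deformations 1"

definition infinitesimal_equiv ::
    "('f::field \<Rightarrow> 'a::comm_ring \<Rightarrow> 'a) \<Rightarrow> ('f \<Rightarrow> 'l::ab_group_add \<Rightarrow> 'l) \<Rightarrow> ('a \<Rightarrow> 'l \<Rightarrow> 'l) \<Rightarrow>
     ('l \<Rightarrow> 'l \<Rightarrow> 'l) \<Rightarrow> ('l \<Rightarrow> 'l) \<Rightarrow> ('l \<Rightarrow> 'a \<Rightarrow> 'a) \<Rightarrow>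
     (('l \<Rightarrow> 'l \<Rightarrow> 'l fps) \<times> ('l \<Rightarrow> 'l fps)) rel" where
  "infinitesimal_equiv scA scL act m w rho =
     {(d, d'). d \<in> infinitesimal_deformations scA scL act m w rho \<and>
               d' \<in> infinitesimal_deformations scA scL act m w rho \<and> deformation_equiv 1 scL d d'}"

definition first_order_part ::
    "('l::zero \<Rightarrow> 'l \<Rightarrow> 'l fps) \<times> ('l \<Rightarrow> 'l fps) \<Rightarrow> ('l \<Rightarrow> 'l \<Rightarrow> 'l) \<times> ('l \<Rightarrow> 'l)" where
  "first_order_part d = ((\<lambda>x y. fst d x y $ 1), (\<lambda>x. snd d x $ 1))"

section \<open>Restricted cohomology with adjoint coefficients\<close>

definition C2 ::
    "('f::field \<Rightarrow> 'l::ab_group_add \<Rightarrow> 'l) \<Rightarrow> (('l \<Rightarrow> 'l \<Rightarrow> 'l) \<times> ('l \<Rightarrow> 'l)) set" where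
  "C2 scL = {(\<phi>, w). bilinear_map scL \<phi> \<and> (\<forall>x. \<phi> x x = 0) \<and> is_quadratic_over scL \<phi> w}"

definition Z2 ::
    "('f::field \<Rightarrow> 'l::ab_group_add \<Rightarrow> 'l) \<Rightarrow> ('l \<Rightarrow> 'l \<Rightarrow> 'l) \<Rightarrow> ('l \<Rightarrow> 'l) \<Rightarrow>
     (('l \<Rightarrow> 'l \<Rightarrow> 'l) \<times> ('l \<Rightarrow> 'l)) set" where
  "Z2 scL br sq = {(\<phi>, w) \<in> C2 scL.
     (\<forall>x y z. \<phi> (br x y) z + \<phi> (br x z) y + \<phi> (br y z) x
        + br x (\<phi> y z) + br y (\<phi> x z) + br z (\<phi> x y) = 0) \<and>
     (\<forall>x z. br x (\<phi> x z) + br z (w x) + \<phi> (sq x) z + \<phi> (br x z) x = 0)}"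

definition B2 ::
    "('f::field \<Rightarrow> 'l::ab_group_add \<Rightarrow> 'l) \<Rightarrow> ('l \<Rightarrow> 'l \<Rightarrow> 'l) \<Rightarrow> ('l \<Rightarrow> 'l) \<Rightarrow>
     (('l \<Rightarrow> 'l \<Rightarrow> 'l) \<times> ('l \<Rightarrow> 'l)) set" where
  "B2 scL br sq = {(\<lambda>x y. \<psi> (br x y) + br x (\<psi> y) + br y (\<psi> x), \<lambda>x. \<psi> (sq x) + br x (\<psi> x)) |\<psi>.
     Vector_Spaces.linear scL scL \<psi>}"

definition cohomologous ::
    "('f::field \<Rightarrow> 'l::ab_group_add \<Rightarrow> 'l) \<Rightarrow> ('l \<Rightarrow> 'l \<Rightarrow> 'l) \<Rightarrow> ('l \<Rightarrow> 'l) \<Rightarrow>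
     (('l \<Rightarrow> 'l \<Rightarrow> 'l) \<times> ('l \<Rightarrow> 'l)) rel" where
  "cohomologous scL br sq = {((\<phi>, w), (\<phi>', w')).
     (\<phi>, w) \<in> Z2 scL br sq \<and> (\<phi>', w') \<in> Z2 scL br sq \<and>
     ((\<lambda>x y. \<phi> x y - \<phi>' x y), (\<lambda>x. w x - w' x)) \<in> B2 scL br sq}"

definition H2 ::
    "('f::field \<Rightarrow> 'l::ab_group_add \<Rightarrow> 'l) \<Rightarrow> ('l \<Rightarrow> 'l \<Rightarrow> 'l) \<Rightarrow> ('l \<Rightarrow> 'l) \<Rightarrow>
     (('l \<Rightarrow> 'l \<Rightarrow> 'l) \<times> ('l \<Rightarrow> 'l)) set set" where
  "H2 scL br sq = Z2 scL br sq // cohomologous scL br sq"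

text \<open>
  Cochains in \<^const>\<open>C2\<close> need not be compatible with the action of \<open>A\<close>, whereas the first-order
  part of a deformation is a restricted multiderivation. The next predicate collects the
  conditions on \<open>(m\<^sub>1, \<omega>\<^sub>1)\<close> that involve \<open>A\<close>; the last one is the coefficient of \<open>t\<close> in the
  compatibility of the symbol maps with \<open>\<omega>\<^sub>t\<close>. Not every class in \<^const>\<open>H2\<close> has a
  representative with this property: take \<open>A = L\<close> the dual numbers over the field with two
  elements, with zero bracket, 2-map and anchor, and the cocycle \<open>(0, w)\<close> with
  \<open>w(a + b \<epsilon>) = b\<close>. If \<open>A\<close> is the ground field, every cocycle has it, with symbol map zero.
\<close>

definition has_compatible_symbol ::
    "('f::field \<Rightarrow> 'a::comm_ring \<Rightarrow> 'a) \<Rightarrow> ('f \<Rightarrow> 'l::ab_group_add \<Rightarrow> 'l) \<Rightarrow> ('a \<Rightarrow> 'l \<Rightarrow> 'l) \<Rightarrow>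
     ('l \<Rightarrow> 'l) \<Rightarrow> ('l \<Rightarrow> 'a \<Rightarrow> 'a) \<Rightarrow> ('l \<Rightarrow> 'l \<Rightarrow> 'l) \<times> ('l \<Rightarrow> 'l) \<Rightarrow> bool" where
  "has_compatible_symbol scA scL act sq rho c \<longleftrightarrow>
     (\<exists>s. multiderivation_with_symbol scA scL act (fst c) (snd c) s \<and>
        (\<forall>x a. rho (snd c x) a + s (sq x) a = rho x (s x a) + s x (rho x a)))"

end

theory Submission
  imports Defs
begin

text \<open>
  Modulo \<open>t\<^sup>2\<close> every condition on a deformation or an equivalence is a condition on the
  coefficients of \<open>1\<close> and \<open>t\<close>. The coefficient of \<open>1\<close> only restates the axioms of \<open>L\<close>; the
  coefficient of \<open>t\<close> says that the first-order part is a cocycle with a compatible symbol, and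
  that \<open>\<phi>\<^sub>1\<close> bounds the difference of two first-order parts. So equivalence of deformations is
  the pullback of the cohomology relation along an injection.
\<close>

section \<open>Quotients by equivalence relations pulled back along a map\<close>

lemma bij_betw_quotient_pullback:
  assumes R: "equiv Z R" and f: "f ` D \<subseteq> Z"
    and E: "E = {(d, d'). d \<in> D \<and> d' \<in> D \<and> (f d, f d') \<in> R}"
  shows "equiv D E"
    and "\<exists>\<Phi>. bij_betw \<Phi> (D // E) {c \<in> Z // R. \<exists>z\<in>c. z \<in> f ` D} \<and>
           (\<forall>d\<in>D. \<Phi> (E `` {d}) = R `` {f d})"
proof -
  have refl: "\<And>d. d \<in> D \<Longrightarrow> (f d, f d) \<in> R"
    using R f by (auto simp: equiv_def refl_on_def)
  have sym: "\<And>a b. (a, b) \<in> R \<Longrightarrow> (b, a) \<in> R"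
    using R by (auto simp: equiv_def sym_def)
  have trans: "\<And>a b c. (a, b) \<in> R \<Longrightarrow> (b, c) \<in> R \<Longrightarrow> (a, c) \<in> R"
    using R by (auto simp: equiv_def dest: transD)
  show eqE: "equiv D E"
  proof (rule equivI)
    show "E \<subseteq> D \<times> D" and "refl_on D E"
      using refl by (auto simp: E refl_on_def)
    show "sym E" and "trans E"
      using sym trans unfolding E sym_def trans_def by blast+
  qed
  \<comment> \<open>The union avoids choosing a representative: on a class of \<open>E\<close> all
    its members are the same set.\<close>
  define \<Phi> where "\<Phi> X = (\<Union>d\<in>X. R `` {f d})" for X
  have \<Phi>: "\<Phi> (E `` {d}) = R `` {f d}" if "d \<in> D" for d
  proof -
    have "R `` {f e} = R `` {f d}" if "e \<in> E `` {d}" for e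
      using that equiv_class_eq[OF R, of "f d" "f e"] by (simp add: E)
    moreover have "d \<in> E `` {d}"
      using that refl by (simp add: E)
    ultimately show ?thesis
      unfolding \<Phi>_def by blast
  qed
  have img: "\<Phi> ` (D // E) = {c \<in> Z // R. \<exists>z\<in>c. z \<in> f ` D}"
  proof (intro equalityI subsetI)
    fix c assume "c \<in> \<Phi> ` (D // E)"
    then obtain d where "d \<in> D" "c = R `` {f d}"
      using \<Phi> by (auto elim!: quotientE)
    then show "c \<in> {c \<in> Z // R. \<exists>z\<in>c. z \<in> f ` D}"
      using f by (auto intro!: quotientI refl)
  next
    fix c assume "c \<in> {c \<in> Z // R. \<exists>z\<in>c. z \<in> f ` D}"
    then obtain d where c: "c \<in> Z // R" "f d \<in> c" and d: "d \<in> D"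
      by auto
    then have "c = \<Phi> (E `` {d})"
      using R \<Phi> by (metis Image_singleton_iff equiv_class_eq quotientE)
    then show "c \<in> \<Phi> ` (D // E)"
      using d by (auto intro: quotientI)
  qed
  have "inj_on \<Phi> (D // E)"
  proof (rule inj_onI)
    fix X Y assume "X \<in> D // E" "Y \<in> D // E" and eq: "\<Phi> X = \<Phi> Y"
    then obtain d d' where d: "d \<in> D" "X = E `` {d}" and d': "d' \<in> D" "Y = E `` {d'}"
      by (auto elim!: quotientE)
    then have "R `` {f d} = R `` {f d'}"
      using eq \<Phi> by simp
    then have "(d, d') \<in> E"
      using d(1) d'(1) refl[of d'] by (auto simp: E)
    then show "X = Y"
      using eqE d d' by (simp add: equiv_class_eq)
  qed
  then show "\<exists>\<Phi>. bij_betw \<Phi> (D // E) {c \<in> Z // R. \<exists>z\<in>c. z \<in> f ` D} \<and>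
           (\<forall>d\<in>D. \<Phi> (E `` {d}) = R `` {f d})"
    using img \<Phi> by (auto simp: bij_betw_def)
qed

section \<open>Power series modulo \<open>t^2\<close>\<close>

lemma le_one_enat_iff: "enat n \<le> 1 \<longleftrightarrow> n = 0 \<or> n = 1"
  by (auto simp: one_enat_def)

lemma eq_upto_one: "eq_upto 1 X Y \<longleftrightarrow> X $ 0 = Y $ 0 \<and> X $ 1 = Y $ 1"
  by (auto simp: eq_upto_def le_one_enat_iff)

lemma ext_m_nth:
  "ext_m mt X Y $ 0 = mt (X $ 0) (Y $ 0) $ 0"
  "ext_m mt X Y $ 1 = mt (X $ 0) (Y $ 0) $ 1 + mt (X $ 0) (Y $ 1) $ 0 + mt (X $ 1) (Y $ 0) $ 0"
  by (simp_all add: ext_m_def)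

lemma ext_lin_nth:
  "ext_lin \<phi>t X $ 0 = \<phi>t (X $ 0) $ 0"
  "ext_lin \<phi>t X $ 1 = \<phi>t (X $ 0) $ 1 + \<phi>t (X $ 1) $ 0"
  by (simp_all add: ext_lin_def)

lemma ext_w_nth:
  "ext_w mt wt X $ 0 = wt (X $ 0) $ 0"
  "ext_w mt wt X $ 1 = wt (X $ 0) $ 1 + mt (X $ 0) (X $ 1) $ 0"
proof -
  \<comment> \<open>The 2-map doubles exponents, so the value of \<open>wt\<close> at
    \<open>X $ 1\<close> starts in degree 2. Up to degree 1, \<open>X $ 1\<close> enters only
    through the cross term of the pair \<open>(0, 1)\<close>.\<close>
  have sets: "{i::nat. 2 * i \<le> 0} = {0}" "{i::nat. 2 * i \<le> 1} = {0}"
    "{(i::nat, j). i < j \<and> i + j \<le> 0} = {}" "{(i::nat, j). i < j \<and> i + j \<le> 1} = {(0, 1)}"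
    by auto
  show "ext_w mt wt X $ 0 = wt (X $ 0) $ 0"
    "ext_w mt wt X $ 1 = wt (X $ 0) $ 1 + mt (X $ 0) (X $ 1) $ 0"
    unfolding ext_w_def fps_nth_Abs_fps sets by simp_all
qed

lemma bilinear_map_zero:
  assumes "bilinear_map scL m"
  shows "m x 0 = 0" "m 0 y = 0"
  using assms module_hom.zero[of scL scL "m x"] module_hom.zero[of scL scL "\<lambda>x. m x y"]
  by (auto simp: bilinear_map_def simp flip: module_hom_iff_linear)

section \<open>Signs in characteristic 2, and the cohomology relation\<close>

context restricted_lie_algebra
begin

lemma add_self: "x + x = (0::'l)"
proof -
  have "(1 + 1 :: 'f) = 0"
    using of_nat_CHAR[where 'a = 'f] by (simp add: char_2)
  then show ?thesis
    by (metis scale_left_distrib scale_one scale_zero_left)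
qed

lemma uminus_eq: "- x = (x::'l)"
  by (simp add: add_self minus_unique)

lemma minus_eq: "x - y = x + (y::'l)"
  using uminus_eq[of y] by (simp only: diff_conv_add_uminus)

text \<open>Collects an equation on one side, so that two equations with differently placed terms
  become the same sum up to order.\<close>

lemma eq_iff_add_eq_0: "x = y \<longleftrightarrow> x + y = (0::'l)"
  by (metis minus_eq right_minus_eq)

lemma br_commute: "br x y = br y x"
proof -
  have "br (x + y) (x + y) = br x x + br x y + (br y x + br y y)"
    using br_bilinear by (simp add: bilinear_map_def Vector_Spaces.linear_iff ac_simps)
  then show ?thesis
    by (simp add: br_self eq_iff_add_eq_0[of "br x y"])
qed

lemma br_zero: "br x 0 = 0" "br 0 x = 0"
  using bilinear_map_zero[OF br_bilinear] by auto

lemma br_add: "br x (y + z) = br x y + br x z"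
  using br_bilinear by (simp add: bilinear_map_def Vector_Spaces.linear_iff)

text \<open>Over a field of characteristic 2, skew-symmetry alone would not give \<open>m x x = 0\<close>.\<close>

lemma quadratic_alternating:
  assumes "is_quadratic_over scL m w"
  shows "m x x = 0"
proof -
  have "w 0 = 0"
    using assms unfolding is_quadratic_over_def by (metis power_zero_numeral scale_zero_left)
  moreover have "w (x + x) = w x + w x + m x x"
    using assms by (simp add: is_quadratic_over_def)
  ultimately show ?thesis
    by (simp add: add_self)
qed

lemma B2_zero: "(\<lambda>x y. 0, \<lambda>x. 0) \<in> B2 scL br sq"
  unfolding B2_def by (auto simp: br_zero Vector_Spaces.linear_iff vector_space_axioms intro!: exI[of _ "\<lambda>x. 0"])

lemma B2_add:
  assumes "(f, u) \<in> B2 scL br sq" "(g, v) \<in> B2 scL br sq"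
  shows "(\<lambda>x y. f x y + g x y, \<lambda>x. u x + v x) \<in> B2 scL br sq"
proof -
  obtain \<psi> where \<psi>: "Vector_Spaces.linear scL scL \<psi>"
    "f = (\<lambda>x y. \<psi> (br x y) + br x (\<psi> y) + br y (\<psi> x))" "u = (\<lambda>x. \<psi> (sq x) + br x (\<psi> x))"
    using assms(1) by (auto simp: B2_def)
  obtain \<chi> where \<chi>: "Vector_Spaces.linear scL scL \<chi>"
    "g = (\<lambda>x y. \<chi> (br x y) + br x (\<chi> y) + br y (\<chi> x))" "v = (\<lambda>x. \<chi> (sq x) + br x (\<chi> x))"
    using assms(2) by (auto simp: B2_def)
  have "Vector_Spaces.linear scL scL (\<lambda>x. \<psi> x + \<chi> x)"
    using \<psi>(1) \<chi>(1) by (simp add: Vector_Spaces.linear_iff scale_right_distrib ac_simps)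
  then show ?thesis
    unfolding B2_def \<psi> \<chi> by (auto simp: br_add ac_simps intro!: exI[of _ "\<lambda>x. \<psi> x + \<chi> x"])
qed

text \<open>Reflexivity and transitivity come from \<open>B2_zero\<close> and \<open>B2_add\<close>.
  Symmetry is immediate, since differences are sums in characteristic 2.\<close>

lemma equiv_cohomologous: "equiv (Z2 scL br sq) (cohomologous scL br sq)"
proof (rule equivI)
  show "cohomologous scL br sq \<subseteq> Z2 scL br sq \<times> Z2 scL br sq"
    by (auto simp: cohomologous_def)
  show "refl_on (Z2 scL br sq) (cohomologous scL br sq)"
    using B2_zero by (auto simp: refl_on_def cohomologous_def)
  show "sym (cohomologous scL br sq)"
    by (auto simp: sym_def cohomologous_def minus_eq add.commute)
  show "trans (cohomologous scL br sq)"
  proof (rule transI)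
    fix a b c assume *: "(a, b) \<in> cohomologous scL br sq" "(b, c) \<in> cohomologous scL br sq"
    obtain f u g v h w where [simp]: "a = (f, u)" "b = (g, v)" "c = (h, w)"
      by (cases a, cases b, cases c) auto
    have "(\<lambda>x y. (f x y - g x y) + (g x y - h x y), \<lambda>x. (u x - v x) + (v x - w x)) \<in> B2 scL br sq"
      using * by (intro B2_add) (auto simp: cohomologous_def)
    then show "(a, c) \<in> cohomologous scL br sq"
      using * by (simp add: cohomologous_def)
  qed
qed

end

section \<open>Infinitesimal deformations as cocycles with a compatible symbol\<close>

context restricted_lie_rinehart
begin

text \<open>Settles the degree 0 part of the symbol condition on a deformation, where the symbol is
  \<open>rho\<close>.\<close>

lemma multiderivation_br: "multiderivation_with_symbol scA scL act br sq rho"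
  unfolding multiderivation_with_symbol_def is_quadratic_over_def
  using br_bilinear sq_scale sq_add rho_derivation rho_act rho_sq sq_act
  by (auto simp: br_act uminus_eq add.commute intro: br_commute)

lemma infinitesimal_deformations_iff:
  "(mt, wt) \<in> infinitesimal_deformations scA scL act br sq rho \<longleftrightarrow>
     (\<forall>x y. mt x y $ 0 = br x y) \<and> (\<forall>x. wt x $ 0 = sq x) \<and>
     (\<forall>i>1. (\<forall>x y. mt x y $ i = 0) \<and> (\<forall>x. wt x $ i = 0)) \<and>
     first_order_part (mt, wt) \<in> Z2 scL br sq \<and>
     has_compatible_symbol scA scL act sq rho (first_order_part (mt, wt))"
  (is "?L \<longleftrightarrow> ?R")
\<comment> \<open>Both sides contain this condition, so it may be assumed and used to rewrite all
  degree 0 coefficients.\<close>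
proof (cases "(\<forall>x y. mt x y $ 0 = br x y) \<and> (\<forall>x. wt x $ 0 = sq x)")
  case False
  then show ?thesis
    by (auto simp: infinitesimal_deformations_def restricted_deformations_def)
next
  case True
  define f u where "f = (\<lambda>x y. mt x y $ 1)" and "u = (\<lambda>x. wt x $ 1)"
  have zeroth: "mt x y $ 0 = br x y" "wt x $ 0 = sq x" for x y
    using True by auto
  have first: "mt x y $ 1 = f x y" "wt x $ 1 = u x" for x y
    by (auto simp: f_def u_def)
  have fop: "first_order_part (mt, wt) = (f, u)"
    by (simp add: first_order_part_def f_def u_def)
  \<comment> \<open>\<open>J\<close>, \<open>K\<close> and \<open>S\<close> are the degree 1 parts
    of the Jacobi identity, of the compatibility of \<open>mt\<close> with \<open>wt\<close>, and of
    the symbol conditions; \<open>H\<close> is the vanishing above degree 1.\<close>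
  define J where "J \<longleftrightarrow> (\<forall>x y z. f x (br y z) + br x (f y z) + (f y (br z x) + br y (f z x))
      + (f z (br x y) + br z (f x y)) = 0)"
  define K where "K \<longleftrightarrow> (\<forall>x y. f x (sq y) + br x (u y) = f (br x y) y + br (f x y) y)"
  define S where "S \<longleftrightarrow> (\<exists>s. multiderivation_with_symbol scA scL act f u s \<and>
        (\<forall>x a. rho (u x) a + s (sq x) a = rho x (s x a) + s x (rho x a)))"
  define H where "H \<longleftrightarrow> (\<forall>i>1. (\<forall>x y. mt x y $ i = 0) \<and> (\<forall>x. wt x $ i = 0))"
  have H: "(\<forall>i. 1 < enat i \<longrightarrow> (\<forall>x y. mt x y $ i = 0) \<and> (\<forall>x. wt x $ i = 0)) \<longleftrightarrow> H"
    by (auto simp: H_def one_enat_def)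
  have J: "(\<forall>x y z. eq_upto 1
        (ext_m mt (fps_const x) (mt y z) + ext_m mt (fps_const y) (mt z x)
          + ext_m mt (fps_const z) (mt x y)) 0) \<longleftrightarrow> J"
    unfolding eq_upto_one fps_add_nth ext_m_nth zeroth first J_def
    by (simp add: br_zero jacobi zeroth)
  have K: "(\<forall>x y. eq_upto 1 (ext_m mt (fps_const x) (wt y)) (ext_m mt (mt x y) (fps_const y))) \<longleftrightarrow> K"
    unfolding eq_upto_one ext_m_nth zeroth first K_def by (simp add: br_zero br_sq zeroth)
  have S: "(\<exists>\<sigma> :: nat \<Rightarrow> 'l \<Rightarrow> 'a \<Rightarrow> 'a. \<sigma> 0 = rho \<and>
        (\<forall>i. enat i \<le> 1 \<longrightarrow>
           multiderivation_with_symbol scA scL act (\<lambda>x y. mt x y $ i) (\<lambda>x. wt x $ i) (\<sigma> i)) \<and>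
        (\<forall>k. enat k \<le> 1 \<longrightarrow>
           (\<forall>x a. (\<Sum>i\<le>k. \<sigma> i (wt x $ (k - i)) a) = (\<Sum>i\<le>k. \<sigma> i x (\<sigma> (k - i) x a))))) \<longleftrightarrow> S"
    (is "(\<exists>\<sigma>. ?P \<sigma>) \<longleftrightarrow> S")
  proof -
    have "?P \<sigma> \<longleftrightarrow> \<sigma> 0 = rho \<and> multiderivation_with_symbol scA scL act f u (\<sigma> 1) \<and>
        (\<forall>x a. rho (u x) a + \<sigma> 1 (sq x) a = rho x (\<sigma> 1 x a) + \<sigma> 1 x (rho x a))" for \<sigma>
      unfolding f_def u_def le_one_enat_iff
      by (cases "\<sigma> 0 = rho") (auto simp: zeroth rho_sq multiderivation_br)
    then have "(\<exists>\<sigma>. ?P \<sigma>) \<longleftrightarrow> (\<exists>\<sigma>. \<sigma> (0::nat) = rho \<and> multiderivation_with_symbol scA scL act f u (\<sigma> 1) \<and>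
        (\<forall>x a. rho (u x) a + \<sigma> 1 (sq x) a = rho x (\<sigma> 1 x a) + \<sigma> 1 x (rho x a)))"
      by (rule ex_cong1)
    also have "\<dots> \<longleftrightarrow> S"
    proof
      assume S
      then obtain s where "multiderivation_with_symbol scA scL act f u s \<and>
          (\<forall>x a. rho (u x) a + s (sq x) a = rho x (s x a) + s x (rho x a))"
        by (auto simp: S_def)
      then show "\<exists>\<sigma>. \<sigma> (0::nat) = rho \<and> multiderivation_with_symbol scA scL act f u (\<sigma> 1) \<and>
          (\<forall>x a. rho (u x) a + \<sigma> 1 (sq x) a = rho x (\<sigma> 1 x a) + \<sigma> 1 x (rho x a))"
        \<comment> \<open>Only the symbols in degrees 0 and 1 are constrained, so \<open>s\<close>
          may fill all higher degrees.\<close>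
        by (intro exI[of _ "\<lambda>i::nat. if i = 0 then rho else s"]) simp
    qed (auto simp: S_def)
    finally show ?thesis .
  qed
  \<comment> \<open>This condition follows from the others: degree 0 is \<open>sq_add\<close>, and
    degree 1 is part of the multiderivation property in \<open>S\<close>.\<close>
  have Q: "\<forall>x y. eq_upto 1 (wt (x + y)) (wt x + wt y + mt x y)" if S
  proof -
    have "is_quadratic_over scL f u"
      using that unfolding S_def multiderivation_with_symbol_def by blast
    then show ?thesis
      by (simp only: is_quadratic_over_def eq_upto_one fps_add_nth zeroth first sq_add simp_thms)
  qed
  have L: "?L \<longleftrightarrow> H \<and> J \<and> K \<and> S"
    unfolding infinitesimal_deformations_def restricted_deformations_def mem_Collect_eq prod.case
      H J K S using Q by (auto simp: zeroth)
  \<comment> \<open>\<open>S\<close> makes \<open>(f, u)\<close> a cochain and \<open>f\<close>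
    symmetric. What remains is to reorder arguments and summands in the two cocycle
    identities.\<close>
  have Z2: "(f, u) \<in> Z2 scL br sq \<longleftrightarrow> J \<and> K" if S
  proof -
    obtain s where s: "multiderivation_with_symbol scA scL act f u s"
      using \<open>S\<close> by (auto simp: S_def)
    have quad: "is_quadratic_over scL f u"
      using s by (simp add: multiderivation_with_symbol_def)
    have fc: "f x y = f y x" for x y
      using s by (metis multiderivation_with_symbol_def uminus_eq)
    have "(f, u) \<in> C2 scL"
      using s quad quadratic_alternating[OF quad]
      unfolding C2_def multiderivation_with_symbol_def by blast
    moreover have "J \<longleftrightarrow> (\<forall>x y z. f (br x y) z + f (br x z) y + f (br y z) x
        + br x (f y z) + br y (f x z) + br z (f x y) = 0)"
    proof -
      have "f x (br y z) + br x (f y z) + (f y (br z x) + br y (f z x))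
          + (f z (br x y) + br z (f x y)) = f (br x y) z + f (br x z) y + f (br y z) x
          + br x (f y z) + br y (f x z) + br z (f x y)" for x y z
        using fc[of x "br y z"] fc[of y "br x z"] fc[of z "br x y"] fc[of z x] br_commute[of z x]
        by (simp add: ac_simps)
      then show ?thesis
        by (simp only: J_def)
    qed
    moreover have "K \<longleftrightarrow> (\<forall>x z. br x (f x z) + br z (u x) + f (sq x) z + f (br x z) x = 0)"
    proof -
      \<comment> \<open>The left side is \<open>K\<close> at the pair \<open>(z, x)\<close>.\<close>
      have "f z (sq x) + br z (u x) = f (br z x) x + br (f z x) x \<longleftrightarrow>
          br x (f x z) + br z (u x) + f (sq x) z + f (br x z) x = 0" for x z
        using fc[of z "sq x"] fc[of z x] br_commute[of z x] br_commute[of "f x z" x]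
        unfolding eq_iff_add_eq_0[of "f z (sq x) + br z (u x)"] by (simp add: ac_simps)
      then show ?thesis
        unfolding K_def by blast
    qed
    ultimately show ?thesis
      by (simp add: Z2_def)
  qed
  have "?R \<longleftrightarrow> H \<and> (f, u) \<in> Z2 scL br sq \<and> S"
    unfolding fop has_compatible_symbol_def fst_conv snd_conv H_def S_def using True by blast
  then show ?thesis
    using L Z2 by blast
qed

text \<open>The coefficient \<open>\<phi>t x $ 1\<close> is the cochain whose coboundary is the
  difference of the first-order parts. The two conditions of an equivalence use
  \<open>\<phi>t\<close> in opposite directions, which agree modulo \<open>t^2\<close>: there, a
  series with constant term the identity is its own inverse in characteristic 2.\<close>

lemma deformation_equiv_iff:
  assumes d: "d \<in> infinitesimal_deformations scA scL act br sq rho"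
    and d': "d' \<in> infinitesimal_deformations scA scL act br sq rho"
  shows "deformation_equiv 1 scL d d' \<longleftrightarrow>
    (first_order_part d, first_order_part d') \<in> cohomologous scL br sq"
proof -
  obtain mt wt where d_eq [simp]: "d = (mt, wt)" by (cases d)
  obtain mt' wt' where d'_eq [simp]: "d' = (mt', wt')" by (cases d')
  define f u where "f = (\<lambda>x y. mt x y $ 1)" and "u = (\<lambda>x. wt x $ 1)"
  define f' u' where "f' = (\<lambda>x y. mt' x y $ 1)" and "u' = (\<lambda>x. wt' x $ 1)"
  have nth: "mt x y $ 0 = br x y" "wt x $ 0 = sq x" "mt' x y $ 0 = br x y" "wt' x $ 0 = sq x"
    "mt x y $ 1 = f x y" "wt x $ 1 = u x" "mt' x y $ 1 = f' x y" "wt' x $ 1 = u' x" for x y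
    using d d' by (auto simp: infinitesimal_deformations_iff f_def u_def f'_def u'_def)
  have Z: "(f, u) \<in> Z2 scL br sq" "(f', u') \<in> Z2 scL br sq"
    using d d' by (auto simp: infinitesimal_deformations_iff first_order_part_def
        f_def u_def f'_def u'_def)
  \<comment> \<open>Here \<open>p\<close>, \<open>q\<close>, \<open>r\<close> stand for the values
    of \<open>\<psi>\<close> at \<open>x\<close>, \<open>y\<close> and \<open>br x y\<close>; in the
    next fact, \<open>p\<close> and \<open>r\<close> stand for those at \<open>x\<close> and
    \<open>sq x\<close>.\<close>
  have 1: "f x y + br x q + br p y = r + f' x y \<longleftrightarrow> f x y - f' x y = r + br x q + br y p"
    for x y p q r
    using br_commute[of p y]
    unfolding minus_eq eq_iff_add_eq_0[of "f x y + f' x y"] eq_iff_add_eq_0[of "f x y + br x q + br p y"]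
    by (simp add: ac_simps)
  have 2: "r + u x = u' x + br x p \<longleftrightarrow> u x - u' x = r + br x p" for x r p
    unfolding minus_eq eq_iff_add_eq_0[of "r + u x"] eq_iff_add_eq_0[of "u x + u' x"]
    by (simp add: ac_simps)
  define P where "P \<psi> \<longleftrightarrow> Vector_Spaces.linear scL scL \<psi> \<and>
    (\<forall>x y. f x y - f' x y = \<psi> (br x y) + br x (\<psi> y) + br y (\<psi> x)) \<and>
    (\<forall>x. u x - u' x = \<psi> (sq x) + br x (\<psi> x))" for \<psi>
  have "deformation_equiv 1 scL d d' \<longleftrightarrow> (\<exists>\<phi>t :: 'l \<Rightarrow> 'l fps.
      (\<forall>i. Vector_Spaces.linear scL scL (\<lambda>x. \<phi>t x $ i)) \<and> (\<forall>x. \<phi>t x $ 0 = x) \<and> P (\<lambda>x. \<phi>t x $ 1))"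
    unfolding deformation_equiv_def d_eq d'_eq prod.case P_def 1[symmetric] 2[symmetric]
    by (intro ex_cong1) (auto simp only: eq_upto_one ext_m_nth ext_lin_nth ext_w_nth nth)
  also have "\<dots> \<longleftrightarrow> (\<exists>\<psi>. P \<psi>)"
  proof
    assume "\<exists>\<psi>. P \<psi>"
    then obtain \<psi> where \<psi>: "P \<psi>" by blast
    \<comment> \<open>Every coefficient of \<open>\<phi>t\<close> must be linear, also above degree
      1; zero serves there.\<close>
    define \<phi>t where "\<phi>t x = Abs_fps (\<lambda>i. if i = 0 then x else if i = 1 then \<psi> x else 0)" for x
    have "Vector_Spaces.linear scL scL (\<lambda>x. \<phi>t x $ i)" for i
      using \<psi> by (auto simp: \<phi>t_def P_def Vector_Spaces.linear_iff vector_space_axioms)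
    moreover have "(\<lambda>x. \<phi>t x $ 1) = \<psi>"
      by (simp add: \<phi>t_def)
    ultimately show "\<exists>\<phi>t :: 'l \<Rightarrow> 'l fps. (\<forall>i. Vector_Spaces.linear scL scL (\<lambda>x. \<phi>t x $ i)) \<and>
        (\<forall>x. \<phi>t x $ 0 = x) \<and> P (\<lambda>x. \<phi>t x $ 1)"
      using \<psi> by (intro exI[of _ \<phi>t]) (simp add: \<phi>t_def)
  qed blast
  also have "\<dots> \<longleftrightarrow> (first_order_part d, first_order_part d') \<in> cohomologous scL br sq"
  proof -
    have "first_order_part d = (f, u)" "first_order_part d' = (f', u')"
      by (simp_all add: first_order_part_def f_def u_def f'_def u'_def)
    then show ?thesis
      using Z by (auto simp: cohomologous_def B2_def P_def fun_eq_iff)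
  qed
  finally show ?thesis .
qed

text \<open>A cocycle \<open>(f, u)\<close> with a compatible symbol is the first-order part of
  \<open>br + t f\<close>, \<open>sq + t u\<close>: modulo \<open>t^2\<close> no further obstruction
  arises.\<close>

lemma first_order_part_image:
  "first_order_part ` infinitesimal_deformations scA scL act br sq rho =
     {z \<in> Z2 scL br sq. has_compatible_symbol scA scL act sq rho z}"
  (is "_ = ?Z")
proof (intro equalityI subsetI)
  fix z assume z: "z \<in> ?Z"
  obtain f u where [simp]: "z = (f, u)" by (cases z)
  define mt where "mt x y = Abs_fps (\<lambda>i. if i = 0 then br x y else if i = 1 then f x y else 0)"
    for x y
  define wt where "wt x = Abs_fps (\<lambda>i. if i = 0 then sq x else if i = 1 then u x else 0)" for x
  have fop: "first_order_part (mt, wt) = z"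
    by (simp add: first_order_part_def mt_def wt_def)
  moreover have "(mt, wt) \<in> infinitesimal_deformations scA scL act br sq rho"
    unfolding infinitesimal_deformations_iff fop using z by (simp add: mt_def wt_def)
  ultimately show "z \<in> first_order_part ` infinitesimal_deformations scA scL act br sq rho"
    by (metis imageI)
qed (auto simp: infinitesimal_deformations_iff)

end

section \<open>The bijection with the cohomology classes that have a compatible
  representative\<close>

theorem theorem5p22:
  fixes scA :: "'f::field \<Rightarrow> 'a::comm_ring \<Rightarrow> 'a"
    and scL :: "'f \<Rightarrow> 'l::ab_group_add \<Rightarrow> 'l"
    and act :: "'a \<Rightarrow> 'l \<Rightarrow> 'l"
    and br :: "'l \<Rightarrow> 'l \<Rightarrow> 'l"
    and sq :: "'l \<Rightarrow> 'l"
    and rho :: "'l \<Rightarrow> 'a \<Rightarrow> 'a"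
  assumes "restricted_lie_rinehart scA scL act br sq rho"
  defines "Def \<equiv> infinitesimal_deformations scA scL act br sq rho"
    and "E \<equiv> infinitesimal_equiv scA scL act br sq rho"
  shows "equiv Def E \<and>
    (\<exists>\<Phi>. bij_betw \<Phi> (Def // E)
           {c \<in> H2 scL br sq. \<exists>z\<in>c. has_compatible_symbol scA scL act sq rho z} \<and>
         (\<forall>d\<in>Def. \<Phi> (E `` {d}) = cohomologous scL br sq `` {first_order_part d}))"
proof -
  interpret restricted_lie_rinehart scA scL act br sq rho by fact
  have E: "E = {(d, d'). d \<in> Def \<and> d' \<in> Def \<and>
      (first_order_part d, first_order_part d') \<in> cohomologous scL br sq}"
    unfolding E_def Def_def infinitesimal_equiv_def using deformation_equiv_iff by blast
  have sub: "first_order_part ` Def \<subseteq> Z2 scL br sq"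
    unfolding Def_def first_order_part_image by blast
  \<comment> \<open>Within a class all elements are cocycles, so those with a compatible symbol are
    exactly the first-order parts of deformations.\<close>
  have "c \<subseteq> Z2 scL br sq" if "c \<in> H2 scL br sq" for c
    using that in_quotient_imp_subset[OF equiv_cohomologous] by (simp add: H2_def)
  then have "{c \<in> H2 scL br sq. \<exists>z\<in>c. has_compatible_symbol scA scL act sq rho z} =
      {c \<in> Z2 scL br sq // cohomologous scL br sq. \<exists>z\<in>c. z \<in> first_order_part ` Def}"
    unfolding Def_def first_order_part_image H2_def by blast
  then show ?thesis
    using bij_betw_quotient_pullback[OF equiv_cohomologous sub E] by simp
qed

end
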